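(* Let $A\in\mathbb{C}^{n\times n}$ be an $H$-matrix, and let $m$ be an integer with $0\le m\le n$. Then the generalized Jacobi (GJ) method with parameter $m$ for the system $Ax=b$ converges for any initial guess $x^{(0)}$.
   Context: A real matrix $C\in\mathbb{R}^{n\times n}$ is an $M$-matrix if $C=sI-B$ with $B\ge 0$ entrywise and $s\ge\rho(B)$, where $\rho$ denotes the spectral radius. The comparison matrix of $A=(a_{ij})\in\mathbb{C}^{n\times n}$ is the matrix $H(A)=(m_{ij})$ with $m_{ii}=|a_{ii}|$ and $m_{ij}=-|a_{ij}|$ for $i\ne j$. $A$ is an $H$-matrix if $H(A)$ is an $M$-matrix. For an $n\times n$ matrix $A=(a_{ij})$ and an integer $0\le m\le n$, write $A=T_m-E_m-F_m$, where $T_m$ has entries $a_{ij}$ if $|i-j|\le m$ and $0$ otherwise; $E_m$ has entries $-a_{ij}$ if $i>j+m$ and $0$ otherwise; $F_m$ has entries $-a_{ij}$ if $j>i+m$ and $0$ otherwise. The GJ method with parameter $m$ is the iteration $$x^{(k+1)}=T_m^{-1}(E_m+F_m)x^{(k)}+T_m^{-1}b,\qquad k\ge 0.$$ "The method converges for any initial guess" means that $T_m$ is invertible (so the iteration is defined) and that for every $b$ and every $x^{(0)}$ in $\mathbb{C}^n$ the sequence $x^{(k)}$ converges to the solution of $Ax=b$; equivalently, $T_m$ is invertible and $\rho(T_m^{-1}(E_m+F_m))<1$.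
   Formalization: The comparison matrix H(A) is additionally assumed nonsingular; with s ≥ ρ(B) alone the claim fails, e.g. for the 1×1 zero matrix, or for A=[[1,1],[1,-1]] with m=0, where the iteration matrix has spectral radius 1. *)

theory Defs
  imports
    Complex_Main
    "Jordan_Normal_Form.Spectral_Radius"
    "Jordan_Normal_Form.Gauss_Jordan_Elimination"
begin

text \<open>Matrices are those of \<open>Jordan_Normal_Form.Matrix\<close>, indexed from 0; the band structure
  below only depends on the difference of the indices.\<close>

definition M_matrix :: "nat \<Rightarrow> real mat \<Rightarrow> bool" where
  "M_matrix n C \<longleftrightarrow> C \<in> carrier_mat n n \<and>
     (\<exists>s B. B \<in> carrier_mat n n \<and> (\<forall>i<n. \<forall>j<n. 0 \<le> B $$ (i, j)) \<and>
            C = s \<cdot>\<^sub>m 1\<^sub>m n - B \<and> spectral_radius (map_mat complex_of_real B) \<le> s)"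

definition comparison_mat :: "nat \<Rightarrow> complex mat \<Rightarrow> real mat" where
  "comparison_mat n A =
     mat n n (\<lambda>(i, j). if i = j then cmod (A $$ (i, j)) else - cmod (A $$ (i, j)))"

definition H_matrix :: "nat \<Rightarrow> complex mat \<Rightarrow> bool" where
  "H_matrix n A \<longleftrightarrow> A \<in> carrier_mat n n \<and> M_matrix n (comparison_mat n A)"

definition T_part :: "nat \<Rightarrow> nat \<Rightarrow> complex mat \<Rightarrow> complex mat" where
  "T_part n m A = mat n n (\<lambda>(i, j). if \<bar>int i - int j\<bar> \<le> int m then A $$ (i, j) else 0)"

definition E_part :: "nat \<Rightarrow> nat \<Rightarrow> complex mat \<Rightarrow> complex mat" where
  "E_part n m A = mat n n (\<lambda>(i, j). if i > j + m then - A $$ (i, j) else 0)"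

definition F_part :: "nat \<Rightarrow> nat \<Rightarrow> complex mat \<Rightarrow> complex mat" where
  "F_part n m A = mat n n (\<lambda>(i, j). if j > i + m then - A $$ (i, j) else 0)"

lemma splitting:
  assumes "A \<in> carrier_mat n n"
  shows "A = T_part n m A - E_part n m A - F_part n m A"
  using assms by (intro eq_matI) (auto simp: T_part_def E_part_def F_part_def)

text \<open>\<open>the (mat_inverse T)\<close> is the inverse of \<open>T\<close> when \<open>T\<close> is invertible and unspecified
  otherwise; \<open>GJ_converges\<close> demands invertibility separately.\<close>

primrec GJ_iter ::
  "nat \<Rightarrow> nat \<Rightarrow> complex mat \<Rightarrow> complex vec \<Rightarrow> complex vec \<Rightarrow> nat \<Rightarrow> complex vec" where
  "GJ_iter n m A b x0 0 = x0"
| "GJ_iter n m A b x0 (Suc k) =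
     (the (mat_inverse (T_part n m A)) * (E_part n m A + F_part n m A)) *\<^sub>v GJ_iter n m A b x0 k
     + the (mat_inverse (T_part n m A)) *\<^sub>v b"

definition GJ_converges :: "nat \<Rightarrow> nat \<Rightarrow> complex mat \<Rightarrow> bool" where
  "GJ_converges n m A \<longleftrightarrow> invertible_mat (T_part n m A) \<and>
     (\<forall>b \<in> carrier_vec n.
        \<exists>!x. x \<in> carrier_vec n \<and> A *\<^sub>v x = b) \<and>
     (\<forall>b \<in> carrier_vec n. \<forall>x0 \<in> carrier_vec n. \<forall>x \<in> carrier_vec n. A *\<^sub>v x = b \<longrightarrow>
        (\<forall>i<n. (\<lambda>k. GJ_iter n m A b x0 k $ i) \<longlonglongrightarrow> x $ i))"

text \<open>With \<open>s \<ge> \<rho>(B)\<close>, singular M-matrices are admitted, and convergence then fails in general: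
  already the zero matrix of order 1 is an H-matrix whose \<open>T\<close>-part is singular.  A convergence
  theorem therefore has to require the comparison matrix to be nonsingular.\<close>

lemma H_matrix_not_sufficient:
  "H_matrix 1 (0\<^sub>m 1 1)" "\<not> GJ_converges 1 m (0\<^sub>m 1 1)"
proof -
  have ev: "spectrum (0\<^sub>m 1 1 :: complex mat) = {0}"
    by (auto simp: spectrum_root_char_poly[of _ 1] char_poly_def char_poly_matrix_def det_single)
  have zero: "map_mat complex_of_real (0\<^sub>m 1 1) = 0\<^sub>m 1 1"
    by (intro eq_matI) auto
  have "spectral_radius (map_mat complex_of_real (0\<^sub>m 1 1)) \<le> 0"
    unfolding spectral_radius_def zero ev by simp
  moreover have "comparison_mat 1 (0\<^sub>m 1 1) = 0 \<cdot>\<^sub>m 1\<^sub>m 1 - 0\<^sub>m 1 1"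
    by (intro eq_matI) (auto simp: comparison_mat_def)
  ultimately have "M_matrix 1 (comparison_mat 1 (0\<^sub>m 1 1))"
    unfolding M_matrix_def
    by (intro conjI exI[of _ 0] exI[of _ "0\<^sub>m 1 1"]) (auto simp: comparison_mat_def)
  then show "H_matrix 1 (0\<^sub>m 1 1)"
    by (simp add: H_matrix_def)
  have "T_part 1 m (0\<^sub>m 1 1) = 0\<^sub>m 1 1"
    by (intro eq_matI) (auto simp: T_part_def)
  moreover have "\<not> invertible_mat (0\<^sub>m 1 1 :: complex mat)"
  proof
    assume "invertible_mat (0\<^sub>m 1 1 :: complex mat)"
    then obtain B :: "complex mat"
      where l: "0\<^sub>m 1 1 * B = 1\<^sub>m 1" and r: "B * 0\<^sub>m 1 1 = 1\<^sub>m (dim_row B)"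
      by (auto simp: invertible_mat_def inverts_mat_def)
    have "B \<in> carrier_mat 1 1"
      using arg_cong[OF l, of dim_col] arg_cong[OF r, of dim_col] by auto
    then have "0\<^sub>m 1 1 = (1\<^sub>m 1 :: complex mat)"
      using l by (simp add: left_mult_zero_mat)
    then show False
      by (auto dest!: arg_cong[where f = "\<lambda>M. M $$ (0, 0)"])
  qed
  ultimately show "\<not> GJ_converges 1 m (0\<^sub>m 1 1)"
    by (simp add: GJ_converges_def)
qed

end

theory Submission
  imports Defs
begin

text \<open>A nonsingular M-matrix \<open>C = sI - B\<close> is inverse nonnegative: if \<open>C u > 0\<close>, then
  \<open>B u \<le> t u\<close> for some \<open>t > s \<ge> \<rho>(B)\<close>, and iterating this inequality yields
  \<open>u \<ge> (B/t)\<^sup>k u \<longrightarrow> 0\<close>. Hence the solution of \<open>H(A) u = 1\<close> is a positive vector,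
  and \<open>A\<close> is strictly diagonally dominant with respect to the weights \<open>u\<close>. In the maximum
  norm weighted by \<open>u\<close>, every splitting \<open>A = T - G\<close> that keeps the diagonal of \<open>A\<close> in \<open>T\<close>
  and distributes the off-diagonal entries of \<open>A\<close> makes \<open>T\<inverse> G\<close> a contraction.\<close>

lemma mult_mat_vec_index_sum:
  assumes "M \<in> carrier_mat n m" "v \<in> carrier_vec m" "i < n"
  shows "(M *\<^sub>v v) $ i = (\<Sum>j<m. M $$ (i, j) * v $ j)"
  using assms by (auto simp: scalar_prod_def atLeast0LessThan intro!: sum.cong)

subsection \<open>Powers and the spectral radius\<close>

lemma smult_pow_mat:
  fixes A :: "'a :: comm_semiring_1 mat"
  assumes A: "A \<in> carrier_mat n n"
  shows "(a \<cdot>\<^sub>m A) ^\<^sub>m k = a ^ k \<cdot>\<^sub>m (A ^\<^sub>m k)"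
proof (induction k)
  case 0
  show ?case using A by (intro eq_matI) auto
next
  case (Suc k)
  have P: "A ^\<^sub>m k \<in> carrier_mat n n" using A by simp
  show ?case
    unfolding pow_mat.simps Suc
    by (intro eq_matI) (use A P in \<open>auto simp: scalar_prod_def sum_distrib_left ac_simps
        simp del: pow_mat.simps intro!: sum.cong\<close>)
qed

lemma spectral_radius_nonneg:
  assumes "A \<in> carrier_mat n n" "0 < n"
  shows "0 \<le> spectral_radius A"
  using spectral_radius_mem_max(1)[OF assms] by auto

text \<open>Dividing by \<open>r\<close> reduces this to a matrix of spectral radius below 1, whose
  powers are bounded entrywise by a single constant. Scaling back contributes the factor
  \<open>r ^ k\<close>.\<close>

lemma spectral_radius_pow_bound:
  assumes A: "A \<in> carrier_mat n n" and n: "0 < n" and r: "spectral_radius A < r"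
  shows "\<exists>c. \<forall>k. norm_bound (A ^\<^sub>m k) (c * r ^ k)"
proof -
  have rpos: "0 < r" using spectral_radius_nonneg[OF A n] r by simp
  define a where "a = inverse (complex_of_real r)"
  have a: "a \<noteq> 0" "cmod a = inverse r" using rpos by (auto simp: a_def norm_inverse)
  let ?N = "a \<cdot>\<^sub>m A"
  have N: "?N \<in> carrier_mat n n" using A by simp
  \<comment> \<open>A dominant eigenvalue \<open>l\<close> of \<open>a \<cdot>\<^sub>m A\<close> is
    carried back to the eigenvalue \<open>l / a\<close> of \<open>A\<close> on the same eigenvector,
    so \<open>cmod l * r\<close> is at most the spectral radius of \<open>A\<close>.\<close>
  obtain l where l: "l \<in> spectrum ?N" "spectral_radius ?N = cmod l"
    using spectral_radius_mem_max(1)[OF N n] by auto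
  then obtain v where v: "v \<in> carrier_vec n" "v \<noteq> 0\<^sub>v n" "?N *\<^sub>v v = l \<cdot>\<^sub>v v"
    using A by (auto simp: spectrum_def eigenvalue_def eigenvector_def)
  have "A *\<^sub>v v = (l / a) \<cdot>\<^sub>v v"
  proof (intro eq_vecI)
    fix i assume "i < dim_vec ((l / a) \<cdot>\<^sub>v v)"
    then have i: "i < n" using v by simp
    have "a * (A *\<^sub>v v) $ i = (?N *\<^sub>v v) $ i"
      using A N v(1) i
      by (simp add: mult_mat_vec_index_sum[of _ n n] sum_distrib_left mult.assoc del: index_mult_mat_vec)
    then show "(A *\<^sub>v v) $ i = ((l / a) \<cdot>\<^sub>v v) $ i"
      using v i a by (simp add: field_simps del: index_mult_mat_vec)
  qed (use A v in auto)
  then have "l / a \<in> spectrum A"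
    using v A by (auto simp: spectrum_def eigenvalue_def eigenvector_def)
  then have "cmod (l / a) \<le> spectral_radius A"
    using spectral_radius_mem_max(2)[OF A n] by auto
  with r have "cmod l * r < 1 * r"
    by (simp add: divide_inverse norm_mult norm_inverse a)
  with rpos l have "spectral_radius ?N < 1" by simp
  then obtain c where c: "\<And>k. norm_bound (?N ^\<^sub>m k) c"
    using spectral_radius_jnf_norm_bound_less_1_upper_triangular[OF N] by blast
  have "norm_bound (A ^\<^sub>m k) (c * r ^ k)" for k
  proof (rule norm_boundI)
    fix i j assume "i < dim_row (A ^\<^sub>m k)" "j < dim_col (A ^\<^sub>m k)"
    moreover from this have "cmod ((?N ^\<^sub>m k) $$ (i, j)) \<le> c"
      using c[of k] by (auto simp: norm_bound_def smult_pow_mat[OF A])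
    ultimately show "cmod ((A ^\<^sub>m k) $$ (i, j)) \<le> c * r ^ k"
      using rpos by (simp add: smult_pow_mat[OF A] norm_mult norm_power a power_inverse field_simps)
  qed
  then show ?thesis by blast
qed

subsection \<open>Inverse nonnegativity of M-matrices\<close>

lemma nonneg_pow_mat:
  fixes B :: "real mat"
  assumes B: "B \<in> carrier_mat n n" "\<And>i j. i < n \<Longrightarrow> j < n \<Longrightarrow> 0 \<le> B $$ (i, j)"
    and ij: "i < n" "j < n"
  shows "0 \<le> (B ^\<^sub>m k) $$ (i, j)"
  using ij
proof (induction k arbitrary: i j)
  case 0
  then show ?case using B(1) by simp
next
  case (Suc k)
  have P: "B ^\<^sub>m k \<in> carrier_mat n n" using B(1) by simp
  show ?case using Suc.prems P B(1)
    by (auto simp: scalar_prod_def intro!: sum_nonneg mult_nonneg_nonneg Suc.IH B(2))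
qed

text \<open>Since \<open>B ^\<^sub>m k\<close> is entrywise nonnegative, it preserves the inequality
  \<open>B u \<le> t u\<close>; each application gains one factor \<open>t\<close>. The sign of
  \<open>u\<close> is left open.\<close>

lemma pow_mat_subinvariant:
  fixes B :: "real mat"
  assumes B: "B \<in> carrier_mat n n" "\<And>i j. i < n \<Longrightarrow> j < n \<Longrightarrow> 0 \<le> B $$ (i, j)"
    and u: "u \<in> carrier_vec n"
    and sub: "\<And>i. i < n \<Longrightarrow> (B *\<^sub>v u) $ i \<le> t * u $ i" and t: "0 \<le> t" and i: "i < n"
  shows "(B ^\<^sub>m k *\<^sub>v u) $ i \<le> t ^ k * u $ i"
  using i
proof (induction k arbitrary: i)
  case 0
  then show ?case using B(1) u by simp
next
  case (Suc k)
  have P: "B ^\<^sub>m k \<in> carrier_mat n n" using B(1) by simp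
  have "(B ^\<^sub>m Suc k *\<^sub>v u) $ i = (B ^\<^sub>m k *\<^sub>v (B *\<^sub>v u)) $ i"
    using assoc_mult_mat_vec[OF P B(1) u] by simp
  also have "\<dots> = (\<Sum>j<n. (B ^\<^sub>m k) $$ (i, j) * (B *\<^sub>v u) $ j)"
    using P B(1) u Suc.prems by (intro mult_mat_vec_index_sum) auto
  also have "\<dots> \<le> (\<Sum>j<n. (B ^\<^sub>m k) $$ (i, j) * (t * u $ j))"
    using Suc.prems by (intro sum_mono mult_left_mono sub nonneg_pow_mat[OF B]) auto
  also have "\<dots> = t * (B ^\<^sub>m k *\<^sub>v u) $ i"
    using P u Suc.prems
    by (simp add: mult_mat_vec_index_sum[of _ n n] sum_distrib_left mult_ac del: index_mult_mat_vec)
  also have "\<dots> \<le> t * (t ^ k * u $ i)"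
    using t Suc by (intro mult_left_mono) auto
  finally show ?case by (simp add: mult.assoc del: index_mult_mat_vec)
qed

text \<open>Iterating bounds \<open>u\<close> below by \<open>(B / t) ^ k u\<close>. The powers of
  \<open>B\<close> grow at most like \<open>r ^ k\<close> for some \<open>r < t\<close>, so this
  lower bound tends to 0.\<close>

lemma subinvariant_nonneg:
  fixes B :: "real mat"
  assumes B: "B \<in> carrier_mat n n" "\<And>i j. i < n \<Longrightarrow> j < n \<Longrightarrow> 0 \<le> B $$ (i, j)"
    and rad: "spectral_radius (map_mat complex_of_real B) < t"
    and u: "u \<in> carrier_vec n"
    and sub: "\<And>i. i < n \<Longrightarrow> (B *\<^sub>v u) $ i \<le> t * u $ i"
    and i: "i < n"
  shows "0 \<le> u $ i"
proof -
  let ?B = "map_mat complex_of_real B"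
  have n: "0 < n" and CB: "?B \<in> carrier_mat n n" using i B(1) by auto
  \<comment> \<open>The gap below \<open>t\<close> leaves room for an intermediate \<open>r\<close>:
    the powers of \<open>B\<close> are \<open>O(r ^ k)\<close>, and \<open>(r / t) ^ k\<close> still
    vanishes.\<close>
  obtain r where r: "spectral_radius ?B < r" "r < t" using rad dense by blast
  have pos: "0 < r" "0 < t" using spectral_radius_nonneg[OF CB n] r by auto
  obtain c where c: "\<And>k. norm_bound (?B ^\<^sub>m k) (c * r ^ k)"
    using spectral_radius_pow_bound[OF CB n r(1)] by blast
  have bound: "\<bar>(B ^\<^sub>m k) $$ (i, j)\<bar> \<le> c * r ^ k" if "j < n" for j k
    using c[of k] that i B(1)
    by (auto simp: norm_bound_def of_real_hom.mat_hom_pow[OF B(1), symmetric])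
  define S where "S = (\<Sum>j<n. \<bar>u $ j\<bar>)"
  have "- (c * S) * (r / t) ^ k \<le> u $ i" for k
  proof -
    have P: "B ^\<^sub>m k \<in> carrier_mat n n" using B(1) by simp
    have "\<bar>(B ^\<^sub>m k *\<^sub>v u) $ i\<bar> \<le> (\<Sum>j<n. \<bar>(B ^\<^sub>m k) $$ (i, j) * u $ j\<bar>)"
      unfolding mult_mat_vec_index_sum[OF P u i] by (rule sum_abs)
    also have "\<dots> \<le> (\<Sum>j<n. c * r ^ k * \<bar>u $ j\<bar>)"
      unfolding abs_mult by (intro sum_mono mult_right_mono bound) auto
    also have "\<dots> = c * S * r ^ k"
      by (simp add: S_def sum_distrib_left mult_ac)
    finally have "- (c * S * r ^ k) \<le> (B ^\<^sub>m k *\<^sub>v u) $ i" by linarith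
    also have "\<dots> \<le> t ^ k * u $ i"
      using pow_mat_subinvariant[OF B u sub _ i] pos by simp
    finally show ?thesis using pos by (simp add: power_divide field_simps)
  qed
  moreover have "(\<lambda>k. - (c * S) * (r / t) ^ k) \<longlonglongrightarrow> - (c * S) * 0"
    using pos r by (intro tendsto_mult tendsto_const LIMSEQ_power_zero) auto
  ultimately show ?thesis
    using LIMSEQ_le_const2[of _ "- (c * S) * 0" "u $ i"] by simp
qed

text \<open>An M-matrix only gives spectral radius at most \<open>s\<close>, whereas
  \<open>subinvariant_nonneg\<close> needs a strict bound. Strict positivity of \<open>C u\<close>
  provides the slack to replace \<open>s\<close> by \<open>s + d\<close> with a small
  \<open>d > 0\<close>.\<close>

lemma M_matrix_inverse_nonneg:
  assumes M: "M_matrix n C" and u: "u \<in> carrier_vec n"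
    and pos: "\<And>i. i < n \<Longrightarrow> 0 < (C *\<^sub>v u) $ i" and i: "i < n"
  shows "0 \<le> u $ i"
proof -
  obtain s B where B: "B \<in> carrier_mat n n" "\<And>i j. i < n \<Longrightarrow> j < n \<Longrightarrow> 0 \<le> B $$ (i, j)"
    and C: "C = s \<cdot>\<^sub>m 1\<^sub>m n - B" and rad: "spectral_radius (map_mat complex_of_real B) \<le> s"
    using M by (auto simp: M_matrix_def)
  have Cu: "(C *\<^sub>v u) $ j = s * u $ j - (B *\<^sub>v u) $ j" if j: "j < n" for j
  proof -
    have "C *\<^sub>v u = (s \<cdot>\<^sub>m 1\<^sub>m n) *\<^sub>v u - B *\<^sub>v u"
      unfolding C using B(1) u by (intro minus_mult_distrib_mat_vec) auto
    moreover have "((s \<cdot>\<^sub>m 1\<^sub>m n) *\<^sub>v u) $ j = (\<Sum>k<n. (s \<cdot>\<^sub>m 1\<^sub>m n) $$ (j, k) * u $ k)"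
      using u j by (intro mult_mat_vec_index_sum) auto
    moreover have "\<dots> = (\<Sum>k<n. if k = j then s * u $ k else 0)"
      using j by (intro sum.cong) auto
    ultimately show ?thesis
      using B(1) u j by (simp del: index_mult_mat_vec)
  qed
  \<comment> \<open>\<open>e\<close> is the least component of \<open>C u\<close>, and
    \<open>S\<close> bounds every \<open>\<bar>u $ j\<bar>\<close>. The choice of \<open>d\<close>
    below ensures \<open>d * \<bar>u $ j\<bar> \<le> e\<close>; the added 1 keeps its denominator
    positive even for \<open>S = 0\<close>.\<close>
  define e where "e = Min ((\<lambda>j. (C *\<^sub>v u) $ j) ` {..<n})"
  define S where "S = (\<Sum>j<n. \<bar>u $ j\<bar>)"
  have e: "0 < e" "\<And>j. j < n \<Longrightarrow> e \<le> (C *\<^sub>v u) $ j"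
  proof -
    have "(\<lambda>j. (C *\<^sub>v u) $ j) ` {..<n} \<noteq> {}" using i by blast
    then show "0 < e"
      unfolding e_def using pos by (subst Min_gr_iff) (auto simp del: index_mult_mat_vec)
  qed (simp add: e_def del: index_mult_mat_vec)
  have S: "0 \<le> S" "\<And>j. j < n \<Longrightarrow> \<bar>u $ j\<bar> \<le> S"
    by (auto simp: S_def sum_nonneg intro!: member_le_sum)
  define d where "d = e / (S + 1)"
  have d: "0 < d" using e S by (simp add: d_def)
  show ?thesis
  proof (rule subinvariant_nonneg[OF B _ u _ i])
    show "spectral_radius (map_mat complex_of_real B) < s + d" using rad d by simp
    fix j assume j: "j < n"
    have "d * \<bar>u $ j\<bar> \<le> d * (S + 1)"
      using S(2)[OF j] d by (intro mult_left_mono) auto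
    also have "\<dots> = e" using S by (simp add: d_def)
    finally have "- (d * u $ j) \<le> e"
      using d by (smt (verit) minus_mult_right mult_left_mono)
    \<comment> \<open>Here \<open>B u = s u - C u \<le> s u - e \<le> s u + d u\<close> in component
      \<open>j\<close>.\<close>
    then show "(B *\<^sub>v u) $ j \<le> (s + d) * u $ j"
      using Cu[OF j] e(2)[OF j] by (simp add: algebra_simps del: index_mult_mat_vec)
  qed auto
qed

text \<open>The weights solve \<open>H(A) u = 1\<close>: nonsingularity supplies the solution, and
  inverse nonnegativity makes it nonnegative. Row \<open>i\<close> of the equation is the weighted
  dominance of row \<open>i\<close> of \<open>A\<close>, with gap exactly 1.\<close>

lemma H_matrix_weights:
  assumes H: "H_matrix n A" and inv: "invertible_mat (comparison_mat n A)"
  obtains u :: "nat \<Rightarrow> real"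
  where "\<And>i. i < n \<Longrightarrow> 0 < u i"
    and "\<And>i. i < n \<Longrightarrow> (\<Sum>j\<in>{..<n} - {i}. cmod (A $$ (i, j)) * u j) < cmod (A $$ (i, i)) * u i"
proof -
  let ?C = "comparison_mat n A"
  have C: "?C \<in> carrier_mat n n" by (simp add: comparison_mat_def)
  obtain R where R: "?C * R = 1\<^sub>m n" "R * ?C = 1\<^sub>m (dim_row R)"
    using inv C by (auto simp: invertible_mat_def inverts_mat_def)
  \<comment> \<open>\<open>invertible_mat\<close> does not fix the shape of the inverse; comparing
    column counts in the two identities forces it to be \<open>n\<close> by
    \<open>n\<close>.\<close>
  have Rc: "R \<in> carrier_mat n n"
    using arg_cong[OF R(1), of dim_col] arg_cong[OF R(2), of dim_col] C by auto
  define one :: "real vec" where "one = vec n (\<lambda>_. 1)"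
  define u where "u = R *\<^sub>v one"
  have one: "one \<in> carrier_vec n" and u: "u \<in> carrier_vec n"
    using Rc by (auto simp: one_def u_def)
  have "?C *\<^sub>v u = one"
    unfolding u_def using C Rc one R(1) by (simp flip: assoc_mult_mat_vec)
  then have Cu: "(?C *\<^sub>v u) $ i = 1" if "i < n" for i
    using that by (simp add: one_def)
  have u0: "0 \<le> u $ i" if "i < n" for i
  proof (rule M_matrix_inverse_nonneg[OF _ u _ that])
    show "M_matrix n ?C" using H by (simp add: H_matrix_def)
  qed (simp add: Cu del: index_mult_mat_vec)
  have dom: "cmod (A $$ (i, i)) * u $ i = 1 + (\<Sum>j\<in>{..<n} - {i}. cmod (A $$ (i, j)) * u $ j)"
    if i: "i < n" for i
  proof -
    have "1 = (\<Sum>j<n. ?C $$ (i, j) * u $ j)"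
      using mult_mat_vec_index_sum[OF C u i] Cu[OF i] by simp
    also have "\<dots> = ?C $$ (i, i) * u $ i + (\<Sum>j\<in>{..<n} - {i}. ?C $$ (i, j) * u $ j)"
      using i by (intro sum.remove) auto
    also have "(\<Sum>j\<in>{..<n} - {i}. ?C $$ (i, j) * u $ j) =
        - (\<Sum>j\<in>{..<n} - {i}. cmod (A $$ (i, j)) * u $ j)"
      unfolding sum_negf[symmetric] using i by (intro sum.cong) (auto simp: comparison_mat_def)
    finally show ?thesis using i by (simp add: comparison_mat_def)
  qed
  show thesis
  proof
    fix i assume i: "i < n"
    have "0 \<le> (\<Sum>j\<in>{..<n} - {i}. cmod (A $$ (i, j)) * u $ j)"
      by (intro sum_nonneg mult_nonneg_nonneg u0) auto
    with dom[OF i] show "(\<Sum>j\<in>{..<n} - {i}. cmod (A $$ (i, j)) * u $ j) < cmod (A $$ (i, i)) * u $ i"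
      by simp
    \<comment> \<open>A zero weight would make the left side of \<open>dom\<close> 0 while its right
      side is at least 1.\<close>
    have "u $ i \<noteq> 0"
      using dom[OF i] \<open>0 \<le> (\<Sum>j\<in>{..<n} - {i}. cmod (A $$ (i, j)) * u $ j)\<close> by auto
    with u0[OF i] show "0 < u $ i" by simp
  qed
qed

subsection \<open>Diagonally dominant splittings\<close>

text \<open>The bound on \<open>v\<close> is read off from the row where
  \<open>cmod (v $ k) / u k\<close> is largest: there the off-diagonal part of \<open>T v\<close>
  cannot absorb the diagonal term. Stating it for solutions of \<open>T v = G w\<close> avoids
  inverting \<open>T\<close>, so that \<open>G = 0\<close> can later prove \<open>T\<close>
  invertible.\<close>

lemma dominant_splitting_contraction:
  fixes T G :: "complex mat" and u :: "nat \<Rightarrow> real"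
  assumes T: "T \<in> carrier_mat n n" and G: "G \<in> carrier_mat n n"
    and u: "\<And>i. i < n \<Longrightarrow> 0 < u i"
    and dom: "\<And>i. i < n \<Longrightarrow> (\<Sum>j\<in>{..<n} - {i}. cmod (T $$ (i, j)) * u j)
        + (\<Sum>j<n. cmod (G $$ (i, j)) * u j) < cmod (T $$ (i, i)) * u i"
  obtains q where "0 \<le> q" "q < 1"
    and "\<forall>v\<in>carrier_vec n. \<forall>w\<in>carrier_vec n. \<forall>c. T *\<^sub>v v = G *\<^sub>v w \<longrightarrow>
        (\<forall>j<n. cmod (w $ j) \<le> c * u j) \<longrightarrow> (\<forall>i<n. cmod (v $ i) \<le> q * c * u i)"
proof -
  define off where "off i = (\<Sum>j\<in>{..<n} - {i}. cmod (T $$ (i, j)) * u j)" for i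
  define g where "g i = (\<Sum>j<n. cmod (G $$ (i, j)) * u j)" for i
  define D where "D i = cmod (T $$ (i, i)) * u i - off i" for i
  have g0: "0 \<le> g i" for i
    unfolding g_def using u by (intro sum_nonneg mult_nonneg_nonneg) (auto intro: less_imp_le)
  have gD: "g i < D i" if "i < n" for i using dom[OF that] by (simp add: g_def D_def off_def)
  \<comment> \<open>\<open>D i\<close> is what dominance leaves of row \<open>i\<close> of
    \<open>T\<close>, and \<open>g i < D i\<close> makes each ratio less than 1. Inserting 0 keeps
    the maximum defined for \<open>n = 0\<close> and gives \<open>0 \<le> q\<close>.\<close>
  define q where "q = Max (insert 0 ((\<lambda>i. g i / D i) ` {..<n}))"
  have q0: "0 \<le> q" by (simp add: q_def)
  have q1: "q < 1"
  proof -
    have "g i / D i < 1" if "i < n" for i using gD[OF that] g0[of i] by (simp add: field_simps)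
    then show ?thesis by (auto simp: q_def)
  qed
  have qD: "g i \<le> q * D i" if "i < n" for i
  proof -
    have "g i / D i \<le> q" using that by (simp add: q_def)
    then show ?thesis using gD[OF that] g0[of i] by (simp add: field_simps)
  qed
  show thesis
  proof (rule that[OF q0 q1], intro ballI allI impI)
    fix v w :: "complex vec" and c i
    assume v: "v \<in> carrier_vec n" and w: "w \<in> carrier_vec n" and eq: "T *\<^sub>v v = G *\<^sub>v w"
      and w_le: "\<forall>j<n. cmod (w $ j) \<le> c * u j" and i: "i < n"
    \<comment> \<open>\<open>d\<close> is the weighted maximum norm of \<open>v\<close>; the maximum
      is over a nonempty set because \<open>i < n\<close>, and it is attained at row
      \<open>k\<close>.\<close>
    define d where "d = Max ((\<lambda>j. cmod (v $ j) / u j) ` {..<n})"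
    have le_d: "cmod (v $ j) \<le> d * u j" if "j < n" for j
    proof -
      have "cmod (v $ j) / u j \<le> d" using that by (simp add: d_def)
      then show ?thesis using u[OF that] by (simp add: field_simps)
    qed
    have "d \<in> (\<lambda>j. cmod (v $ j) / u j) ` {..<n}" unfolding d_def using i by (intro Max_in) auto
    then obtain k where k: "k < n" "cmod (v $ k) = d * u k"
      using u by (force simp: field_simps)
    have "T $$ (k, k) * v $ k + (\<Sum>j\<in>{..<n} - {k}. T $$ (k, j) * v $ j) = (T *\<^sub>v v) $ k"
      unfolding mult_mat_vec_index_sum[OF T v k(1)] using k by (intro sum.remove[symmetric]) auto
    also have "\<dots> = (\<Sum>j<n. G $$ (k, j) * w $ j)"
      unfolding eq mult_mat_vec_index_sum[OF G w k(1)] ..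
    finally have split: "T $$ (k, k) * v $ k =
        (\<Sum>j<n. G $$ (k, j) * w $ j) - (\<Sum>j\<in>{..<n} - {k}. T $$ (k, j) * v $ j)"
      by (simp add: algebra_simps)
    \<comment> \<open>Bounding row \<open>k\<close> with \<open>cmod (v $ j) \<le> d * u j\<close>
      off the diagonal gives \<open>d * D k \<le> c * g k\<close>, hence
      \<open>d \<le> q * c\<close>.\<close>
    have "cmod (T $$ (k, k)) * u k * d = cmod (T $$ (k, k) * v $ k)"
      by (simp add: norm_mult k)
    also have "\<dots> \<le> cmod (\<Sum>j<n. G $$ (k, j) * w $ j)
        + cmod (\<Sum>j\<in>{..<n} - {k}. T $$ (k, j) * v $ j)"
      unfolding split by (rule norm_triangle_ineq4)
    also have "cmod (\<Sum>j<n. G $$ (k, j) * w $ j) \<le> (\<Sum>j<n. cmod (G $$ (k, j)) * (c * u j))"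
      by (rule sum_norm_le) (auto simp: norm_mult intro!: mult_left_mono w_le[rule_format])
    also have "\<dots> = c * g k" by (simp add: g_def sum_distrib_left mult_ac)
    also have "cmod (\<Sum>j\<in>{..<n} - {k}. T $$ (k, j) * v $ j)
        \<le> (\<Sum>j\<in>{..<n} - {k}. cmod (T $$ (k, j)) * (d * u j))"
      by (rule sum_norm_le) (auto simp: norm_mult intro!: mult_left_mono le_d)
    also have "\<dots> = d * off k" by (simp add: off_def sum_distrib_left mult_ac)
    finally have "d * D k \<le> c * g k" by (simp add: D_def algebra_simps)
    \<comment> \<open>The sign of \<open>c\<close> is forced by the bound on \<open>w\<close> at
      \<open>k\<close>, since the modulus there is nonnegative.\<close>
    moreover have "0 \<le> c * u k" using w_le[rule_format, OF k(1)] norm_ge_zero order_trans by blast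
    then have c0: "0 \<le> c" using u[OF k(1)] by (simp add: zero_le_mult_iff)
    ultimately have "d * D k \<le> c * (q * D k)"
      using mult_left_mono[OF qD[OF k(1)] c0] by linarith
    then have "d * D k \<le> (q * c) * D k" by (simp only: mult_ac)
    moreover have "0 < D k" using gD[OF k(1)] g0[of k] by linarith
    ultimately have "d \<le> q * c" by (rule mult_right_le_imp_le)
    then have "d * u i \<le> q * c * u i"
      using u[OF i] by (intro mult_right_mono) auto
    with le_d[OF i] show "cmod (v $ i) \<le> q * c * u i" by linarith
  qed
qed

text \<open>The contraction estimate with \<open>G = 0\<close> shows that \<open>T\<close> has
  trivial kernel, so its determinant is nonzero.\<close>

lemma mat_inverse_dominant:
  fixes T :: "complex mat" and u :: "nat \<Rightarrow> real"
  assumes T: "T \<in> carrier_mat n n"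
    and u: "\<And>i. i < n \<Longrightarrow> 0 < u i"
    and dom: "\<And>i. i < n \<Longrightarrow>
        (\<Sum>j\<in>{..<n} - {i}. cmod (T $$ (i, j)) * u j) < cmod (T $$ (i, i)) * u i"
  obtains R where "mat_inverse T = Some R" "T * R = 1\<^sub>m n" "R * T = 1\<^sub>m n" "R \<in> carrier_mat n n"
proof -
  have Z: "0\<^sub>m n n \<in> carrier_mat n n" by simp
  have dom0: "(\<Sum>j\<in>{..<n} - {i}. cmod (T $$ (i, j)) * u j)
        + (\<Sum>j<n. cmod ((0\<^sub>m n n :: complex mat) $$ (i, j)) * u j) < cmod (T $$ (i, i)) * u i"
    if "i < n" for i
    using dom[OF that] that by simp
  obtain q where "0 \<le> q" "q < 1" and q: "\<forall>v\<in>carrier_vec n. \<forall>w\<in>carrier_vec n. \<forall>c. T *\<^sub>v v = 0\<^sub>m n n *\<^sub>v w \<longrightarrow>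
        (\<forall>j<n. cmod (w $ j) \<le> c * u j) \<longrightarrow> (\<forall>i<n. cmod (v $ i) \<le> q * c * u i)"
    by (rule dominant_splitting_contraction[OF T Z u dom0])
  have "v = 0\<^sub>v n" if v: "v \<in> carrier_vec n" "T *\<^sub>v v = 0\<^sub>v n" for v
  proof (intro eq_vecI)
    fix i assume "i < dim_vec (0\<^sub>v n)"
    then have i: "i < n" by simp
    \<comment> \<open>With \<open>w = 0\<close> the estimate may be used with \<open>c = 0\<close>,
      which forces every component of \<open>v\<close> to vanish.\<close>
    have "T *\<^sub>v v = 0\<^sub>m n n *\<^sub>v 0\<^sub>v n" using v(2) by (auto intro!: eq_vecI)
    from q[rule_format, OF v(1) _ this, of 0 i] i show "v $ i = 0\<^sub>v n $ i" by simp
  qed (use v in simp)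
  then have "det T \<noteq> 0" using det_0_iff_vec_prod_zero_field[OF T] by blast
  then have "mat_inverse T \<noteq> None"
    using det_non_zero_imp_unit[OF T, of "()"] mat_inverse(1)[OF T, of "()"] by blast
  then obtain R where "mat_inverse T = Some R" by blast
  with mat_inverse(2)[OF T this] that show thesis by blast
qed

section \<open>Convergence of the generalized Jacobi iteration\<close>

theorem theorem2p11:
  fixes n m :: nat and A :: "complex mat"
  assumes "A \<in> carrier_mat n n"
    and "H_matrix n A"
    and "invertible_mat (comparison_mat n A)"
    and "m \<le> n"
  shows "GJ_converges n m A"
proof -
  note A = assms(1)
  obtain u :: "nat \<Rightarrow> real" where u: "\<And>i. i < n \<Longrightarrow> 0 < u i"
    and dom: "\<And>i. i < n \<Longrightarrow>
        (\<Sum>j\<in>{..<n} - {i}. cmod (A $$ (i, j)) * u j) < cmod (A $$ (i, i)) * u i"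
    using H_matrix_weights[OF assms(2,3)] by metis
  let ?T = "T_part n m A" and ?G = "E_part n m A + F_part n m A"
  have T: "?T \<in> carrier_mat n n" and G: "?G \<in> carrier_mat n n"
    by (auto simp: T_part_def E_part_def F_part_def)
  have [simp]: "dim_row (F_part n m A) = n" "dim_col (F_part n m A) = n"
    by (simp_all add: F_part_def)
  have ATG: "A = ?T - ?G"
    using A by (intro eq_matI) (auto simp: T_part_def E_part_def F_part_def)
  have domTG: "(\<Sum>j\<in>{..<n} - {i}. cmod (?T $$ (i, j)) * u j) + (\<Sum>j<n. cmod (?G $$ (i, j)) * u j)
      < cmod (?T $$ (i, i)) * u i" if i: "i < n" for i
  proof -
    \<comment> \<open>The diagonal lies within every band, so \<open>E_part + F_part\<close>
      vanishes on it.\<close>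
    have "(\<Sum>j<n. cmod (?G $$ (i, j)) * u j) = (\<Sum>j\<in>{..<n} - {i}. cmod (?G $$ (i, j)) * u j)"
      using i by (intro sum.mono_neutral_right) (auto simp: E_part_def F_part_def)
    then have "(\<Sum>j\<in>{..<n} - {i}. cmod (?T $$ (i, j)) * u j) + (\<Sum>j<n. cmod (?G $$ (i, j)) * u j)
        = (\<Sum>j\<in>{..<n} - {i}. (cmod (?T $$ (i, j)) + cmod (?G $$ (i, j))) * u j)"
      by (simp only: sum.distrib distrib_right)
    also have "\<dots> = (\<Sum>j\<in>{..<n} - {i}. cmod (A $$ (i, j)) * u j)"
    \<comment> \<open>Up to sign, each entry of \<open>A\<close> goes to exactly one of the band
      part and the remainder, so the moduli add without loss.\<close>
    proof (rule sum.cong[OF refl])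
      fix j assume "j \<in> {..<n} - {i}"
      then have "j < n" by simp
      with i have "cmod (?T $$ (i, j)) + cmod (?G $$ (i, j)) = cmod (A $$ (i, j))"
        by (cases "\<bar>int i - int j\<bar> \<le> int m") (auto simp: T_part_def E_part_def F_part_def)
      then show "(cmod (?T $$ (i, j)) + cmod (?G $$ (i, j))) * u j = cmod (A $$ (i, j)) * u j"
        by simp
    qed
    finally have "(\<Sum>j\<in>{..<n} - {i}. cmod (?T $$ (i, j)) * u j) + (\<Sum>j<n. cmod (?G $$ (i, j)) * u j)
        = (\<Sum>j\<in>{..<n} - {i}. cmod (A $$ (i, j)) * u j)" .
    with dom[OF i] i show ?thesis by (simp add: T_part_def)
  qed
  have domT: "(\<Sum>j\<in>{..<n} - {i}. cmod (?T $$ (i, j)) * u j) < cmod (?T $$ (i, i)) * u i"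
    if "i < n" for i
  proof -
    have "0 \<le> (\<Sum>j<n. cmod (?G $$ (i, j)) * u j)"
      using u by (intro sum_nonneg mult_nonneg_nonneg) (auto intro: less_imp_le)
    with domTG[OF that] show ?thesis by linarith
  qed
  obtain R where R: "mat_inverse ?T = Some R" "?T * R = 1\<^sub>m n" "R * ?T = 1\<^sub>m n"
      "R \<in> carrier_mat n n"
    by (rule mat_inverse_dominant[OF T u domT])
  \<comment> \<open>\<open>A\<close> is itself dominant with the same weights, which settles unique
    solvability of \<open>A x = b\<close>.\<close>
  obtain S where S: "A * S = 1\<^sub>m n" "S * A = 1\<^sub>m n" "S \<in> carrier_mat n n"
    by (rule mat_inverse_dominant[OF A u dom])
  obtain q where q: "0 \<le> q" "q < 1"
    and contr: "\<forall>v\<in>carrier_vec n. \<forall>w\<in>carrier_vec n. \<forall>c. ?T *\<^sub>v v = ?G *\<^sub>v w \<longrightarrow>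
        (\<forall>j<n. cmod (w $ j) \<le> c * u j) \<longrightarrow> (\<forall>i<n. cmod (v $ i) \<le> q * c * u i)"
    by (rule dominant_splitting_contraction[OF T G u domTG])
  have "invertible_mat ?T"
    using T R by (auto simp: invertible_mat_def inverts_mat_def)
  moreover have "\<exists>!x. x \<in> carrier_vec n \<and> A *\<^sub>v x = b" if b: "b \<in> carrier_vec n" for b
  proof (rule ex1I)
    show "S *\<^sub>v b \<in> carrier_vec n \<and> A *\<^sub>v (S *\<^sub>v b) = b"
      using A S b by (simp flip: assoc_mult_mat_vec)
  next
    fix x assume x: "x \<in> carrier_vec n \<and> A *\<^sub>v x = b"
    then have "S *\<^sub>v b = (S * A) *\<^sub>v x" using assoc_mult_mat_vec[OF S(3) A] by auto
    then show "x = S *\<^sub>v b" using S x by simp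
  qed
  moreover have "(\<lambda>k. GJ_iter n m A b x0 k $ i) \<longlonglongrightarrow> x $ i"
    if b: "b \<in> carrier_vec n" and x0: "x0 \<in> carrier_vec n" and x: "x \<in> carrier_vec n"
      and sol: "A *\<^sub>v x = b" and i: "i < n" for b x0 x i
  proof -
    let ?y = "GJ_iter n m A b x0"
    have y: "?y k \<in> carrier_vec n" for k
      using x0 R b G by (induction k) auto
    \<comment> \<open>Error equation: subtract \<open>T x = G x + b\<close> from
      \<open>T y' = G y + b\<close>, where \<open>y'\<close> is the iterate after
      \<open>y\<close>.\<close>
    have step: "?T *\<^sub>v (?y (Suc k) - x) = ?G *\<^sub>v (?y k - x)" for k
    proof -
      have "?T *\<^sub>v ?y (Suc k) = ?T *\<^sub>v (R * ?G *\<^sub>v ?y k) + ?T *\<^sub>v (R *\<^sub>v b)"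
        unfolding GJ_iter.simps R(1) option.sel using T R(4) G y[of k] b
        by (intro mult_add_distrib_mat_vec) auto
      also have "?T *\<^sub>v (R * ?G *\<^sub>v ?y k) = (?T * R) *\<^sub>v (?G *\<^sub>v ?y k)"
        using T R(4) G y[of k] by simp
      also have "\<dots> = ?G *\<^sub>v ?y k"
        unfolding R(2) using G y[of k] by simp
      also have "?T *\<^sub>v (R *\<^sub>v b) = (?T * R) *\<^sub>v b"
        using T R(4) b by simp
      also have "\<dots> = b"
        unfolding R(2) using b by simp
      finally have 1: "?T *\<^sub>v ?y (Suc k) = ?G *\<^sub>v ?y k + b" .
      have "(?T - ?G) *\<^sub>v x = b" using sol ATG by simp
      then have 2: "?T *\<^sub>v x - ?G *\<^sub>v x = b"
        using minus_mult_distrib_mat_vec[OF T G x] by simp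
      have "?T *\<^sub>v ?y (Suc k) - ?T *\<^sub>v x = ?G *\<^sub>v ?y k - ?G *\<^sub>v x"
      proof (intro eq_vecI)
        fix j assume "j < dim_vec (?G *\<^sub>v ?y k - ?G *\<^sub>v x)"
        then have j: "j < n" using G by simp
        have "(?T *\<^sub>v x) $ j - (?G *\<^sub>v x) $ j = b $ j"
          unfolding 2[symmetric] using G j by (simp del: index_mult_mat_vec)
        then show "(?T *\<^sub>v ?y (Suc k) - ?T *\<^sub>v x) $ j = (?G *\<^sub>v ?y k - ?G *\<^sub>v x) $ j"
          unfolding 1 using T G b j
          by (simp add: algebra_simps del: index_mult_mat_vec)
      qed (use T G in simp)
      then show ?thesis
        using mult_minus_distrib_mat_vec[OF T y[of "Suc k"] x]
          mult_minus_distrib_mat_vec[OF G y[of k] x] by simp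
    qed
    \<comment> \<open>The sum of the weighted initial errors dominates each of them, so the bound
      holds at \<open>k = 0\<close>; each step then contributes a factor \<open>q\<close>.\<close>
    define c where "c = (\<Sum>j<n. cmod (x0 $ j - x $ j) / u j)"
    have bound: "cmod ((?y k - x) $ j) \<le> q ^ k * c * u j" if "j < n" for j k
      using that
    proof (induction k arbitrary: j)
      case 0
      have "cmod (x0 $ j - x $ j) / u j \<le> c"
        unfolding c_def using 0 u
        by (intro member_le_sum) (auto intro!: divide_nonneg_pos)
      then show ?case using u[OF 0] 0 x by (simp add: field_simps)
    next
      case (Suc k)
      show ?case
        using contr[rule_format, OF _ _ step Suc.IH Suc.prems] y x by (simp add: mult.assoc del: GJ_iter.simps)
    qed
    have "(\<lambda>k. q ^ k * c * u i) \<longlonglongrightarrow> 0 * c * u i"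
      using q by (intro tendsto_mult tendsto_const LIMSEQ_power_zero) auto
    then have lim: "(\<lambda>k. q ^ k * c * u i) \<longlonglongrightarrow> 0" by simp
    have "(\<lambda>k. (?y k - x) $ i) \<longlonglongrightarrow> 0"
    proof (rule tendsto_0_le[OF lim])
      show "\<forall>\<^sub>F k in sequentially. cmod ((?y k - x) $ i) \<le> norm (q ^ k * c * u i) * 1"
        using bound[OF i] by (intro always_eventually allI) (simp only: real_norm_def, smt (verit))
    qed
    then show ?thesis
      using x i by (simp add: LIM_zero_iff)
  qed
  ultimately show ?thesis by (auto simp: GJ_converges_def)
qed

end
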